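(* Let $X:\Omega\to[0,\infty]$ be a nonnegative random variable on a probability space $(\Omega,\mathcal{F},P)$, and let $f:(0,\infty)\to\mathbb{R}$ be a concave function, extended to $f:[0,\infty]\to[-\infty,\infty]$ by $f(0):=\lim_{x\downarrow0}f(x)$ and $f(\infty):=\lim_{x\to\infty}f(x)$. If $\mathbb{E}[f(X)]$ is defined, then for any $\sigma$-field $\mathcal{G}\subset\mathcal{F}$, $$\mathbb{E}[f(X)\mid\mathcal{G}]\le f(\mathbb{E}[X\mid\mathcal{G}])\quad\text{a.s.}$$ Additionally, if $\mathbb{E}[f(\mathbb{E}[X\mid\mathcal{G}])]$ is also defined, then $\mathbb{E}[f(X)]\le\mathbb{E}[f(\mathbb{E}[X\mid\mathcal{G}])]$.
   Context: The expectation of a random variable $Y:\Omega\to[-\infty,\infty]$ is defined if $\min(\mathbb{E}[Y^+],\mathbb{E}[Y^-])<\infty$, where $y^+=\max(0,y)$ and $y^-=\max(0,-y)$; then $\mathbb{E}[Y]:=\mathbb{E}[Y^+]-\mathbb{E}[Y^-]\in[-\infty,\infty]$, and the generalized conditional expectation is $\mathbb{E}[Y\mid\mathcal{G}]:=\mathbb{E}[Y^+\mid\mathcal{G}]-\mathbb{E}[Y^-\mid\mathcal{G}]$, which is a.s. a well-defined element of $[-\infty,\infty]$. $X$ is not assumed integrable and may take the value $\infty$. *)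

theory Defs
  imports "HOL-Probability.Probability"
begin

definition pos_part :: "ereal \<Rightarrow> ennreal" where
  "pos_part y = e2ennreal (max 0 y)"

definition neg_part :: "ereal \<Rightarrow> ennreal" where
  "neg_part y = e2ennreal (max 0 (- y))"

definition ereal_expectation_defined :: "'a measure \<Rightarrow> ('a \<Rightarrow> ereal) \<Rightarrow> bool" where
  "ereal_expectation_defined M Y \<longleftrightarrow>
     min (\<integral>\<^sup>+ \<omega>. pos_part (Y \<omega>) \<partial>M) (\<integral>\<^sup>+ \<omega>. neg_part (Y \<omega>) \<partial>M) < \<infinity>"

(* Meaningful only under ereal_expectation_defined: subtraction on ereal is total,
   with \<infinity> - \<infinity> = \<infinity>. *)
definition ereal_expectation :: "'a measure \<Rightarrow> ('a \<Rightarrow> ereal) \<Rightarrow> ereal" where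
  "ereal_expectation M Y =
     enn2ereal (\<integral>\<^sup>+ \<omega>. pos_part (Y \<omega>) \<partial>M) - enn2ereal (\<integral>\<^sup>+ \<omega>. neg_part (Y \<omega>) \<partial>M)"

(* If the expectation of Y is defined, the undefined difference \<infinity> - \<infinity> occurs only
   on a null set. *)
definition ereal_cond_exp :: "'a measure \<Rightarrow> 'a measure \<Rightarrow> ('a \<Rightarrow> ereal) \<Rightarrow> 'a \<Rightarrow> ereal" where
  "ereal_cond_exp M G Y \<omega> =
     enn2ereal (nn_cond_exp M G (\<lambda>\<omega>. pos_part (Y \<omega>)) \<omega>)
     - enn2ereal (nn_cond_exp M G (\<lambda>\<omega>. neg_part (Y \<omega>)) \<omega>)"

(* Only the values of f on the open half-line are used. For f concave there, both limits
   exist in the extended reals. *)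
definition extend_by_limits :: "(real \<Rightarrow> real) \<Rightarrow> ennreal \<Rightarrow> ereal" where
  "extend_by_limits f x =
     (if x = 0 then Lim (at_right 0) (\<lambda>t. ereal (f t))
      else if x = \<infinity> then Lim at_top (\<lambda>t. ereal (f t))
      else ereal (f (enn2real x)))"

end

theory Submission
  imports Defs
begin

text \<open>
  Write \<open>m = E[X | G]\<close>. A supporting line of \<open>f\<close> at \<open>m\<close> is an affine majorant with
  \<open>G\<close>-measurable coefficients; conditioning \<open>f(X) \<le> a + b X\<close> on \<open>G\<close> and evaluating at \<open>m\<close>
  gives the claim. Since neither \<open>X\<close> nor the coefficients are integrable, the inequality is
  conditioned in the form \<open>f(X)\<^sup>+ + a\<^sup>- + b\<^sup>- X \<le> f(X)\<^sup>- + a\<^sup>+ + b\<^sup>+ X\<close>, all of whose terms are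
  nonnegative. This yields \<open>E[f(X)\<^sup>+ | G] + f(m)\<^sup>- \<le> E[f(X)\<^sup>- | G] + f(m)\<^sup>+\<close> almost surely; both
  assertions follow, the second after integration.
\<close>

section \<open>Supergradients and limits of concave functions on the half-line\<close>

text \<open>The slope is minus the infimum of the right difference quotients of the convex function
  \<open>- f\<close>, that is, the right derivative of \<open>f\<close>. Every point of the open
  half-line is interior, so it exists everywhere.\<close>

lemma concave_on_supergradient:
  fixes f :: "real \<Rightarrow> real"
  assumes "concave_on {0<..} f"
  obtains s where "\<And>x t. 0 < x \<Longrightarrow> 0 < t \<Longrightarrow> f t \<le> f x + s x * (t - x)"
proof
  fix x t :: real
  assume "0 < x" "0 < t"
  then show "f t \<le> f x + (- Inf ((\<lambda>t. (- f x - - f t) / (x - t)) ` ({x<..} \<inter> {0<..}))) * (t - x)"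
    using convex_le_Inf_differential[of "{0<..}" "\<lambda>x. - f x" x t] assms
    by (simp add: concave_on_def interior_open)
qed

text \<open>Adding the supporting inequalities at \<open>x\<close> and \<open>y\<close> cancels the
  values of \<open>f\<close>. This monotonicity later makes the slope Borel measurable.\<close>

lemma supergradient_antimono:
  fixes f s :: "real \<Rightarrow> real"
  assumes s: "\<And>x t. 0 < x \<Longrightarrow> 0 < t \<Longrightarrow> f t \<le> f x + s x * (t - x)"
    and "0 < x" "x \<le> y"
  shows "s y \<le> s x"
proof (cases "x = y")
  case False
  then have "s y * (y - x) \<le> s x * (y - x)"
    using s[of x y] s[of y x] assms(2,3) by (simp add: algebra_simps)
  then show ?thesis
    using False assms(3) by simp
qed simp

lemma mono_on_tendsto_INF_at_right:
  fixes g :: "real \<Rightarrow> ereal"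
  assumes "a < b" "mono_on {a<..<b} g"
  shows "(g \<longlongrightarrow> (INF t\<in>{a<..<b}. g t)) (at_right a)"
proof (rule decreasing_tendsto)
  show "\<forall>\<^sub>F t in at_right a. (INF t\<in>{a<..<b}. g t) \<le> g t"
    using eventually_at_right_real[OF \<open>a < b\<close>] by eventually_elim (auto intro: INF_lower)
  fix x assume "(INF t\<in>{a<..<b}. g t) < x"
  then obtain u where u: "u \<in> {a<..<b}" "g u < x"
    by (auto simp: INF_less_iff)
  then have "\<forall>\<^sub>F t in at_right a. t \<in> {a<..<u}"
    by (intro eventually_at_right_real) auto
  then show "\<forall>\<^sub>F t in at_right a. g t < x"
  proof eventually_elim
    case (elim t)
    then have "g t \<le> g u"
      using u by (intro mono_onD[OF assms(2)]) auto
    then show ?case using u(2) by simp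
  qed
qed

lemma mono_on_tendsto_SUP_at_top:
  fixes g :: "real \<Rightarrow> ereal"
  assumes "mono_on {a<..} g"
  shows "(g \<longlongrightarrow> (SUP t\<in>{a<..}. g t)) at_top"
proof (rule increasing_tendsto)
  show "\<forall>\<^sub>F t in at_top. g t \<le> (SUP t\<in>{a<..}. g t)"
    using eventually_gt_at_top[of a] by eventually_elim (auto intro: SUP_upper)
  fix x assume "x < (SUP t\<in>{a<..}. g t)"
  then obtain u where u: "u \<in> {a<..}" "x < g u"
    by (auto simp: less_SUP_iff)
  show "\<forall>\<^sub>F t in at_top. x < g t"
    using eventually_ge_at_top[of u]
  proof eventually_elim
    case (elim t)
    then have "g u \<le> g t"
      using u by (intro mono_onD[OF assms]) auto
    then show ?case using u(2) by simp
  qed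
qed

text \<open>\<open>Lim\<close> says something only once convergence is known. On (0,1) the slopes
  are at least \<open>s 1\<close>, so \<open>f t - s 1 * t\<close> increases there and tends to its
  infimum, possibly -\<infinity>; the subtracted term vanishes at 0.\<close>

lemma tendsto_extend_by_limits_0:
  assumes "concave_on {0<..} f"
  shows "((\<lambda>t. ereal (f t)) \<longlongrightarrow> extend_by_limits f 0) (at_right 0)"
proof -
  obtain s where s: "\<And>x t. 0 < x \<Longrightarrow> 0 < t \<Longrightarrow> f t \<le> f x + s x * (t - x)"
    using concave_on_supergradient[OF assms] by blast
  let ?g = "\<lambda>t. ereal (f t - s 1 * t)"
  have "mono_on {0<..<1} ?g"
  proof (rule mono_onI)
    fix t u :: real assume tu: "t \<in> {0<..<1}" "u \<in> {0<..<1}" "t \<le> u"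
    have "s 1 \<le> s u"
      using tu by (intro supergradient_antimono[where f = f and s = s] s) auto
    then have "s u * (t - u) \<le> s 1 * (t - u)"
      using tu(3) by (intro mult_right_mono_neg) auto
    then show "?g t \<le> ?g u"
      using s[of u t] tu by (simp add: algebra_simps)
  qed
  then have "(?g \<longlongrightarrow> (INF t\<in>{0<..<1}. ?g t)) (at_right 0)"
    by (intro mono_on_tendsto_INF_at_right) auto
  moreover have "((\<lambda>t. ereal (s 1 * t)) \<longlongrightarrow> ereal (s 1 * 0)) (at_right 0)"
    by (intro tendsto_intros)
  ultimately have "((\<lambda>t. ?g t + ereal (s 1 * t)) \<longlongrightarrow> (INF t\<in>{0<..<1}. ?g t) + ereal (s 1 * 0)) (at_right 0)"
    by (intro tendsto_add_ereal_general1) auto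
  then have "((\<lambda>t. ereal (f t)) \<longlongrightarrow> (INF t\<in>{0<..<1}. ?g t)) (at_right 0)"
    by (simp flip: zero_ereal_def)
  then show ?thesis
    by (simp add: extend_by_limits_def tendsto_Lim)
qed

lemma tendsto_MInfty_affine_majorant:
  assumes "b < 0" "\<And>t. 0 < t \<Longrightarrow> f t \<le> a + b * t"
  shows "((\<lambda>t. ereal (f t)) \<longlongrightarrow> -\<infinity>) at_top"
  unfolding tendsto_MInfty
proof
  fix r :: real
  show "\<forall>\<^sub>F t in at_top. ereal (f t) < ereal r"
    using eventually_gt_at_top[of 0] eventually_gt_at_top[of "(r - a) / b"]
  proof eventually_elim
    case (elim t)
    then have "b * t < r - a"
      using assms(1) by (simp add: neg_divide_less_eq mult.commute)
    then show ?case
      using assms(2)[of t] elim by simp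
  qed
qed

text \<open>Either some supporting line has negative slope and forces \<open>f\<close> to
  -\<infinity>, or all slopes are nonnegative and \<open>f\<close> increases to its supremum. Each
  case keeps a majorant for use where E[X | G] is infinite: a decreasing line, or the limit
  itself.\<close>

lemma extend_by_limits_top_cases:
  assumes "concave_on {0<..} f"
  obtains (minus_infinity) a b where "extend_by_limits f \<infinity> = -\<infinity>"
      "((\<lambda>t. ereal (f t)) \<longlongrightarrow> -\<infinity>) at_top" "b < 0" "\<And>t. 0 < t \<Longrightarrow> f t \<le> a + b * t"
    | (bound) "((\<lambda>t. ereal (f t)) \<longlongrightarrow> extend_by_limits f \<infinity>) at_top"
      "\<And>t. 0 < t \<Longrightarrow> ereal (f t) \<le> extend_by_limits f \<infinity>"
proof -
  obtain s where s: "\<And>x t. 0 < x \<Longrightarrow> 0 < t \<Longrightarrow> f t \<le> f x + s x * (t - x)"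
    using concave_on_supergradient[OF assms] by blast
  show thesis
  proof (cases "\<exists>x>0. s x < 0")
    case True
    then obtain x where x: "0 < x" "s x < 0" by blast
    have *: "f t \<le> (f x - s x * x) + s x * t" if "0 < t" for t
      using s[OF x(1) that] by (simp add: algebra_simps)
    have lim: "((\<lambda>t. ereal (f t)) \<longlongrightarrow> -\<infinity>) at_top"
      using x(2) * by (rule tendsto_MInfty_affine_majorant)
    then have "extend_by_limits f \<infinity> = -\<infinity>"
      by (simp add: extend_by_limits_def tendsto_Lim)
    then show thesis
      using lim x(2) * by (rule minus_infinity)
  next
    case False
    have "mono_on {0<..} (\<lambda>t. ereal (f t))"
    proof (rule mono_onI)
      fix t u :: real assume tu: "t \<in> {0<..}" "u \<in> {0<..}" "t \<le> u"
      have "s u * (t - u) \<le> 0"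
        using False tu by (intro mult_nonneg_nonpos) (auto simp: not_less dest: spec[of _ u])
      then show "ereal (f t) \<le> ereal (f u)"
        using s[of u t] tu by simp
    qed
    then have lim: "((\<lambda>t. ereal (f t)) \<longlongrightarrow> (SUP t\<in>{0<..}. ereal (f t))) at_top"
      by (rule mono_on_tendsto_SUP_at_top)
    then have "extend_by_limits f \<infinity> = (SUP t\<in>{0<..}. ereal (f t))"
      by (simp add: extend_by_limits_def tendsto_Lim)
    with lim show thesis
      by (intro bound) (auto intro: SUP_upper)
  qed
qed

lemma tendsto_extend_by_limits_top:
  assumes "concave_on {0<..} f"
  shows "((\<lambda>t. ereal (f t)) \<longlongrightarrow> extend_by_limits f \<infinity>) at_top"
  by (cases rule: extend_by_limits_top_cases[OF assms]) auto

lemma extend_by_limits_ennreal [simp]: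
  "0 < t \<Longrightarrow> extend_by_limits f (ennreal t) = ereal (f t)"
  by (simp add: extend_by_limits_def)

lemma borel_measurable_extend_by_limits:
  assumes "concave_on {0<..} f"
  shows "extend_by_limits f \<in> borel_measurable borel"
proof -
  have "continuous_on {0<..} f"
    using convex_on_continuous[of "{0<..}" "\<lambda>x. - f x"] assms
    by (auto simp: concave_on_def dest: continuous_on_minus)
  \<comment> \<open>Off the half-line \<open>f\<close> is arbitrary and need not be Borel;
    composition with \<open>exp\<close> only sees positive arguments.\<close>
  then have "continuous_on UNIV (\<lambda>x. f (exp x))"
    by (rule continuous_on_compose2) (auto intro: continuous_intros)
  then have [measurable]: "(\<lambda>x. f (exp x)) \<in> borel_measurable borel"
    by (rule borel_measurable_continuous_onI)
  have "extend_by_limits f x = (if x = 0 then extend_by_limits f 0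
      else if x = \<infinity> then extend_by_limits f \<infinity> else ereal (f (exp (ln (enn2real x)))))" for x
    by (cases x) (auto simp: extend_by_limits_def)
  then have "extend_by_limits f = (\<lambda>x. if x = 0 then extend_by_limits f 0
      else if x = \<infinity> then extend_by_limits f \<infinity> else ereal ((\<lambda>y. f (exp y)) (ln (enn2real x))))"
    by auto
  then show ?thesis
    by (elim ssubst) measurable
qed

section \<open>Positive and negative parts of extended reals\<close>

lemma borel_measurable_pos_part [measurable]: "pos_part \<in> borel_measurable borel"
  and borel_measurable_neg_part [measurable]: "neg_part \<in> borel_measurable borel"
  unfolding pos_part_def [abs_def] neg_part_def [abs_def] by measurable

lemma pos_part_simps [simp]:
  "pos_part (ereal r) = ennreal r" "pos_part \<infinity> = \<infinity>" "pos_part (-\<infinity>) = 0"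
  by (auto simp: pos_part_def max_def ennreal_neg simp flip: zero_ereal_def)

lemma neg_part_simps [simp]:
  "neg_part (ereal r) = ennreal (- r)" "neg_part \<infinity> = 0" "neg_part (-\<infinity>) = \<infinity>"
  by (auto simp: neg_part_def max_def ennreal_neg simp flip: zero_ereal_def)

lemma pos_part_minus_neg_part: "enn2ereal (pos_part y) - enn2ereal (neg_part y) = y"
proof (cases y)
  case (real r)
  then show ?thesis
    by (cases "0 \<le> r") (auto simp: ennreal_neg enn2ereal_ennreal zero_ennreal.rep_eq simp flip: zero_ereal_def)
qed (auto simp: zero_ennreal.rep_eq)

text \<open>\<open>ennreal\<close> truncates at 0, so \<open>ennreal a\<close> and
  \<open>ennreal (- a)\<close> are the positive and negative parts of \<open>a\<close>. All terms
  are finite, so the parts can be recombined by subtraction.\<close>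

lemma ennreal_affine_le_iff:
  assumes "0 \<le> p" "0 \<le> n" "0 \<le> t"
  shows "ennreal p + ennreal (- a) + ennreal (- b) * ennreal t
      \<le> ennreal n + ennreal a + ennreal b * ennreal t \<longleftrightarrow> p - n \<le> a + b * t"
proof -
  have pos: "ennreal x = ennreal (max 0 x)" for x
    by (simp add: max_def ennreal_neg)
  have diff: "max 0 x = x + max 0 (- x)" for x :: real
    by simp
  have sum: "ennreal q + ennreal x + ennreal y * ennreal t = ennreal (q + max 0 x + max 0 y * t)"
    if "0 \<le> q" for q x y
    using that assms(3) by (subst (2 3) pos) (simp add: ennreal_mult)
  show ?thesis
    unfolding sum[OF assms(1)] sum[OF assms(2)]
    using assms by (subst ennreal_le_iff, simp) (simp add: diff[of a] diff[of b] distrib_right, linarith)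
qed

text \<open>If \<open>z\<close> is infinite, the right side is \<infinity>, also for infinite
  \<open>z'\<close> by the convention \<infinity> - \<infinity> = \<infinity>. If only
  \<open>z'\<close> is infinite, then \<open>p'\<close> must be, and finiteness of \<open>p\<close>
  makes the left side -\<infinity>.\<close>

lemma enn2ereal_diff_mono:
  assumes le: "p + z' \<le> p' + z" and fin: "p < \<infinity> \<or> p' < \<infinity>"
  shows "enn2ereal p - enn2ereal p' \<le> enn2ereal z - enn2ereal z'"
proof (cases p; cases p')
  fix r r' assume r: "0 \<le> r" "p = ennreal r" "0 \<le> r'" "p' = ennreal r'"
  show ?thesis
  proof (cases z; cases z')
    fix q q' assume "0 \<le> q" "z = ennreal q" "0 \<le> q'" "z' = ennreal q'"
    then show ?thesis
      using le r by (simp add: enn2ereal_ennreal flip: ennreal_plus)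
  qed (use le r in \<open>auto simp: enn2ereal_ennreal top_unique\<close>)
qed (use assms in \<open>auto simp: enn2ereal_ennreal top_unique\<close>)

text \<open>Positive and negative parts of all quantities are moved to opposite sides, so that the
  inequality makes sense in \<open>[0, \<infinity>]\<close> and survives conditioning without integrability.\<close>

lemma extend_by_limits_affine_majorant:
  assumes f: "concave_on {0<..} f" and le: "\<And>t. 0 < t \<Longrightarrow> f t \<le> a + b * t"
  shows "pos_part (extend_by_limits f x) + ennreal (- a) + ennreal (- b) * x
    \<le> neg_part (extend_by_limits f x) + ennreal a + ennreal b * x"
proof -
  have const: "pos_part y + ennreal (- a) \<le> neg_part y + ennreal a" if "y \<le> ereal a" for y
  proof (cases y)
    case (real r)
    then show ?thesis
      using that ennreal_affine_le_iff[of "max 0 r" "max 0 (- r)" 0 a 0] by simp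
  qed (use that in auto)
  consider "x = 0" | t where "x = ennreal t" "0 < t" | "x = \<infinity>"
    by (cases x) (auto simp: less_le)
  then show ?thesis
  proof cases
    assume x: "x = 0"
    have "extend_by_limits f 0 \<le> ereal a"
    proof (rule tendsto_le[OF _ _ tendsto_extend_by_limits_0[OF f]])
      have "((\<lambda>t. ereal (a + b * t)) \<longlongrightarrow> ereal (a + b * 0)) (at_right 0)"
        by (intro tendsto_intros)
      then show "((\<lambda>t. ereal (a + b * t)) \<longlongrightarrow> ereal a) (at_right 0)"
        by simp
      show "\<forall>\<^sub>F t in at_right 0. ereal (f t) \<le> ereal (a + b * t)"
        using eventually_at_right_less[of 0] by eventually_elim (simp add: le)
    qed simp
    with const x show ?thesis by simp
  next
    fix t assume x: "x = ennreal t" "0 < t"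
    then show ?thesis
      using ennreal_affine_le_iff[of "max 0 (f t)" "max 0 (- f t)" t a b] le[of t] by simp
  next
    assume x: "x = \<infinity>"
    consider "b < 0" | "b = 0" | "0 < b" by linarith
    then show ?thesis
    proof cases
      \<comment> \<open>Here the left side is infinite; the right side is too because
        \<open>f\<close> tends to -\<infinity>, which makes the negative part infinite.\<close>
      assume "b < 0"
      then have "((\<lambda>t. ereal (f t)) \<longlongrightarrow> -\<infinity>) at_top"
        using le by (rule tendsto_MInfty_affine_majorant)
      then have "extend_by_limits f \<infinity> = -\<infinity>"
        by (simp add: extend_by_limits_def tendsto_Lim)
      then show ?thesis by (simp add: x)
    next
      assume b: "b = 0"
      have "extend_by_limits f \<infinity> \<le> ereal a"
      proof (rule tendsto_upperbound[OF tendsto_extend_by_limits_top[OF f]])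
        show "\<forall>\<^sub>F t in at_top. ereal (f t) \<le> ereal a"
          using eventually_gt_at_top[of 0] by eventually_elim (use le b in simp)
      qed simp
      with const x b show ?thesis by simp
    next
      assume "0 < b"
      then show ?thesis by (simp add: x ennreal_mult_top)
    qed
  qed
qed

section \<open>Conditioning\<close>

text \<open>Additivity and pulling out \<open>F\<close>-measurable factors hold in [0, \<infinity>]
  without integrability. The coefficients may be infinite, which is used for the infinite slope at
  0.\<close>

lemma (in sigma_finite_subalgebra) nn_cond_exp_affine:
  assumes [measurable]: "a \<in> borel_measurable F" "b \<in> borel_measurable F"
    "U \<in> borel_measurable M" "X \<in> borel_measurable M"
  shows "AE \<omega> in M. nn_cond_exp M F (\<lambda>\<omega>. U \<omega> + a \<omega> + b \<omega> * X \<omega>) \<omega>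
    = nn_cond_exp M F U \<omega> + a \<omega> + b \<omega> * nn_cond_exp M F X \<omega>"
proof -
  have [measurable]: "a \<in> borel_measurable M" "b \<in> borel_measurable M"
    using assms by (auto intro: measurable_from_subalg[OF subalg])
  have "AE \<omega> in M. nn_cond_exp M F (\<lambda>\<omega>. U \<omega> + a \<omega>) \<omega> + nn_cond_exp M F (\<lambda>\<omega>. b \<omega> * X \<omega>) \<omega>
      = nn_cond_exp M F (\<lambda>\<omega>. U \<omega> + a \<omega> + b \<omega> * X \<omega>) \<omega>"
    by (rule nn_cond_exp_sum) auto
  moreover have "AE \<omega> in M. nn_cond_exp M F U \<omega> + nn_cond_exp M F a \<omega> = nn_cond_exp M F (\<lambda>\<omega>. U \<omega> + a \<omega>) \<omega>"
    by (rule nn_cond_exp_sum) auto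
  moreover have "AE \<omega> in M. a \<omega> = nn_cond_exp M F a \<omega>"
    by (rule nn_cond_exp_F_meas) auto
  moreover have "AE \<omega> in M. b \<omega> * nn_cond_exp M F X \<omega> = nn_cond_exp M F (\<lambda>\<omega>. b \<omega> * X \<omega>) \<omega>"
    by (rule nn_cond_exp_prod) auto
  ultimately show ?thesis
    by eventually_elim simp
qed

lemma (in sigma_finite_subalgebra) nn_cond_exp_affine_mono:
  assumes [measurable]: "a \<in> borel_measurable F" "b \<in> borel_measurable F" "c \<in> borel_measurable F"
    "d \<in> borel_measurable F"
    "U \<in> borel_measurable M" "V \<in> borel_measurable M" "X \<in> borel_measurable M"
    and le: "\<And>\<omega>. U \<omega> + a \<omega> + b \<omega> * X \<omega> \<le> V \<omega> + c \<omega> + d \<omega> * X \<omega>"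
  shows "AE \<omega> in M. nn_cond_exp M F U \<omega> + a \<omega> + b \<omega> * nn_cond_exp M F X \<omega>
    \<le> nn_cond_exp M F V \<omega> + c \<omega> + d \<omega> * nn_cond_exp M F X \<omega>"
proof -
  have [measurable]: "a \<in> borel_measurable M" "b \<in> borel_measurable M"
    "c \<in> borel_measurable M" "d \<in> borel_measurable M"
    using assms by (auto intro: measurable_from_subalg[OF subalg])
  have "AE \<omega> in M. nn_cond_exp M F (\<lambda>\<omega>. U \<omega> + a \<omega> + b \<omega> * X \<omega>) \<omega>
      \<le> nn_cond_exp M F (\<lambda>\<omega>. V \<omega> + c \<omega> + d \<omega> * X \<omega>) \<omega>"
    using le by (intro nn_cond_exp_mono) auto
  with nn_cond_exp_affine[OF assms(1,2,5,7)] nn_cond_exp_affine[OF assms(3,4,6,7)] show ?thesis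
    by eventually_elim simp
qed

lemma (in sigma_finite_subalgebra) nn_integral_nn_cond_exp:
  assumes "U \<in> borel_measurable M"
  shows "(\<integral>\<^sup>+ \<omega>. nn_cond_exp M F U \<omega> \<partial>M) = (\<integral>\<^sup>+ \<omega>. U \<omega> \<partial>M)"
  using nn_cond_exp_intg[of "\<lambda>_. 1" U] assms by simp

text \<open>Three affine majorants are conditioned, one for each range of \<open>m\<close>: the
  supporting line at \<open>m\<close> for 0 < \<open>m\<close> < \<infinity>, one of infinite slope
  for \<open>m\<close> = 0, and a fixed line for \<open>m\<close> = \<infinity>. They are combined
  pointwise at the end.\<close>

lemma (in sigma_finite_subalgebra) nn_cond_exp_parts_extend_by_limits_le:
  assumes f: "concave_on {0<..} f" and [measurable]: "X \<in> borel_measurable M"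
  defines "m \<equiv> nn_cond_exp M F X"
    and "P \<equiv> nn_cond_exp M F (\<lambda>\<omega>. pos_part (extend_by_limits f (X \<omega>)))"
    and "N \<equiv> nn_cond_exp M F (\<lambda>\<omega>. neg_part (extend_by_limits f (X \<omega>)))"
  shows "AE \<omega> in M. P \<omega> + neg_part (extend_by_limits f (m \<omega>))
    \<le> N \<omega> + pos_part (extend_by_limits f (m \<omega>))"
proof -
  note [measurable] = borel_measurable_extend_by_limits[OF f]
  have m [measurable]: "m \<in> borel_measurable F"
    unfolding m_def by measurable
  have majorant: "AE \<omega> in M. P \<omega> + ennreal (- a \<omega>) + ennreal (- b \<omega>) * m \<omega>
      \<le> N \<omega> + ennreal (a \<omega>) + ennreal (b \<omega>) * m \<omega>"
    if [measurable]: "a \<in> borel_measurable F" "b \<in> borel_measurable F"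
      and "\<And>\<omega> t. 0 < t \<Longrightarrow> f t \<le> a \<omega> + b \<omega> * t" for a b
    unfolding P_def N_def m_def
    by (rule nn_cond_exp_affine_mono) (auto intro!: extend_by_limits_affine_majorant f that(3))
  obtain s where s: "\<And>x t. 0 < x \<Longrightarrow> 0 < t \<Longrightarrow> f t \<le> f x + s x * (t - x)"
    using concave_on_supergradient[OF f] by blast

  text \<open>The affine majorant touching at \<open>m\<close>. The detour through \<open>exp (ln _)\<close> extends it,
    measurably, to the junk values at \<open>m \<in> {0, \<infinity>}\<close>.\<close>
  have "mono (\<lambda>y. - s (exp y))"
    by (intro monoI) (auto intro!: supergradient_antimono[where f = f and s = s] s)
  then have "(\<lambda>y. - s (exp y)) \<in> borel_measurable borel"
    by (rule borel_measurable_mono)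
  then have s_exp [measurable]: "(\<lambda>y. s (exp y)) \<in> borel_measurable borel"
    by (simp add: borel_measurable_uminus_eq)
  \<comment> \<open>Since \<open>exp y\<close> is positive and finite, measurability of the
    extension passes to \<open>f\<close> composed with \<open>exp\<close>.\<close>
  have "(\<lambda>y. real_of_ereal (extend_by_limits f (ennreal (exp y)))) \<in> borel_measurable borel"
    by measurable
  then have f_exp [measurable]: "(\<lambda>y. f (exp y)) \<in> borel_measurable borel"
    by simp
  define l where "l \<omega> = ln (enn2real (m \<omega>))" for \<omega>
  have l [measurable]: "l \<in> borel_measurable F"
    unfolding l_def [abs_def] by measurable
  have interior: "AE \<omega> in M. P \<omega> + ennreal (- (f (exp (l \<omega>)) - s (exp (l \<omega>)) * exp (l \<omega>)))
        + ennreal (- s (exp (l \<omega>))) * m \<omega>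
      \<le> N \<omega> + ennreal (f (exp (l \<omega>)) - s (exp (l \<omega>)) * exp (l \<omega>)) + ennreal (s (exp (l \<omega>))) * m \<omega>"
  proof (rule majorant)
    show "(\<lambda>\<omega>. s (exp (l \<omega>))) \<in> borel_measurable F"
      using measurable_compose[OF l s_exp] .
    moreover have "(\<lambda>\<omega>. f (exp (l \<omega>))) \<in> borel_measurable F"
      using measurable_compose[OF l f_exp] .
    ultimately show "(\<lambda>\<omega>. f (exp (l \<omega>)) - s (exp (l \<omega>)) * exp (l \<omega>)) \<in> borel_measurable F"
      by measurable
    show "f t \<le> f (exp (l \<omega>)) - s (exp (l \<omega>)) * exp (l \<omega>) + s (exp (l \<omega>)) * t" if "0 < t" for \<omega> t
      using s[of "exp (l \<omega>)" t] that by (simp add: algebra_simps)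
  qed

  text \<open>At \<open>m = 0\<close> the slope is \<open>\<infinity>\<close>, which uses \<open>\<infinity> * 0 = 0\<close>.\<close>
  have zero: "AE \<omega> in M. P \<omega> + neg_part (extend_by_limits f 0) + 0 * m \<omega>
      \<le> N \<omega> + pos_part (extend_by_limits f 0) + \<infinity> * m \<omega>"
    unfolding P_def N_def m_def
  proof (rule nn_cond_exp_affine_mono)
    show "pos_part (extend_by_limits f (X \<omega>)) + neg_part (extend_by_limits f 0) + 0 * X \<omega>
      \<le> neg_part (extend_by_limits f (X \<omega>)) + pos_part (extend_by_limits f 0) + \<infinity> * X \<omega>" for \<omega>
      \<comment> \<open>For \<open>X \<omega> = 0\<close> the two sides agree up to order; otherwise
        the right side is infinite.\<close>
      by (cases "X \<omega> = 0") (auto simp: add.commute ennreal_top_mult)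
  qed auto

  \<comment> \<open>A decreasing line forces \<open>N \<omega> = \<infinity>\<close> where
    \<open>m \<omega> = \<infinity>\<close>. Otherwise a finite limit is a constant majorant, and an
    infinite one makes the right side infinite.\<close>
  have top: "AE \<omega> in M. m \<omega> = \<infinity> \<longrightarrow> P \<omega> + neg_part (extend_by_limits f \<infinity>)
      \<le> N \<omega> + pos_part (extend_by_limits f \<infinity>)"
    using f
  proof (cases rule: extend_by_limits_top_cases)
    case (minus_infinity a b)
    then have "AE \<omega> in M. P \<omega> + ennreal (- a) + ennreal (- b) * m \<omega>
        \<le> N \<omega> + ennreal a + ennreal b * m \<omega>"
      by (intro majorant) auto
    then show ?thesis
      by eventually_elim
        (use minus_infinity in \<open>auto simp: ennreal_mult_top ennreal_neg top_unique\<close>)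
  next
    case bound
    show ?thesis
    proof (cases "extend_by_limits f \<infinity>")
      case (real c)
      then have "AE \<omega> in M. P \<omega> + ennreal (- c) + ennreal (- 0) * m \<omega>
          \<le> N \<omega> + ennreal c + ennreal 0 * m \<omega>"
        using bound by (intro majorant) auto
      then show ?thesis
        by eventually_elim (use real in simp)
    next
      case MInf
      then show ?thesis using bound(2)[of 1] by simp
    qed simp
  qed

  show ?thesis
    using interior zero top
  proof eventually_elim
    case (elim \<omega>)
    consider "m \<omega> = 0" | t where "m \<omega> = ennreal t" "0 < t" | "m \<omega> = \<infinity>"
      by (cases "m \<omega>") (auto simp: less_le)
    then show ?case
    proof cases
      fix t assume t: "m \<omega> = ennreal t" "0 < t"
      then have "exp (l \<omega>) = t"
        by (simp add: l_def)
      with elim(1) t have *: "P \<omega> + ennreal (- (f t - s t * t)) + ennreal (- s t) * ennreal t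
          \<le> N \<omega> + ennreal (f t - s t * t) + ennreal (s t) * ennreal t"
        by simp
      show ?thesis
      \<comment> \<open>Finite \<open>N \<omega>\<close> makes the right side of \<open>*\<close>
        finite, hence \<open>P \<omega>\<close> as well. The line has value \<open>f t\<close> at
        \<open>t\<close>, so \<open>*\<close> becomes \<open>p - n \<le> f t\<close>, which is split
        back into parts as an affine inequality of slope 0.\<close>
      proof (cases "N \<omega>")
        case (real n)
        then have "P \<omega> \<noteq> \<infinity>"
          using * by (auto simp: top_unique ennreal_mult_eq_top_iff)
        then obtain p where "0 \<le> p" "P \<omega> = ennreal p"
          by (cases "P \<omega>") auto
        with * real t show ?thesis
          using ennreal_affine_le_iff[of p n t "f t - s t * t" "s t"]
            ennreal_affine_le_iff[of p n 0 "f t" 0] by simp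
      qed simp
    qed (use elim in auto)
  qed
qed

section \<open>From the inequality between parts to extended real expectations\<close>

theorem lemmaA1:
  fixes M G :: "'a measure" and X :: "'a \<Rightarrow> ennreal" and f :: "real \<Rightarrow> real"
  assumes "prob_space M"
    and "X \<in> borel_measurable M"
    and "concave_on {0<..} f"
    and "ereal_expectation_defined M (\<lambda>\<omega>. extend_by_limits f (X \<omega>))"
    and "subalgebra M G"
  shows "(AE \<omega> in M. ereal_cond_exp M G (\<lambda>\<omega>. extend_by_limits f (X \<omega>)) \<omega>
            \<le> extend_by_limits f (nn_cond_exp M G X \<omega>))
    \<and> (ereal_expectation_defined M (\<lambda>\<omega>. extend_by_limits f (nn_cond_exp M G X \<omega>))
        \<longrightarrow> ereal_expectation M (\<lambda>\<omega>. extend_by_limits f (X \<omega>))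
              \<le> ereal_expectation M (\<lambda>\<omega>. extend_by_limits f (nn_cond_exp M G X \<omega>)))"
proof -
  interpret prob_space M by fact
  interpret finite_measure_subalgebra M G
    by unfold_locales fact
  note [measurable] = assms(2) borel_measurable_extend_by_limits[OF assms(3)]
  let ?Y = "\<lambda>\<omega>. extend_by_limits f (X \<omega>)"
  let ?Z = "\<lambda>\<omega>. extend_by_limits f (nn_cond_exp M G X \<omega>)"
  let ?P = "nn_cond_exp M G (\<lambda>\<omega>. pos_part (?Y \<omega>))"
  let ?N = "nn_cond_exp M G (\<lambda>\<omega>. neg_part (?Y \<omega>))"
  have le: "AE \<omega> in M. ?P \<omega> + neg_part (?Z \<omega>) \<le> ?N \<omega> + pos_part (?Z \<omega>)"
    using assms(3,2) by (rule nn_cond_exp_parts_extend_by_limits_le)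
  have P: "(\<integral>\<^sup>+ \<omega>. ?P \<omega> \<partial>M) = (\<integral>\<^sup>+ \<omega>. pos_part (?Y \<omega>) \<partial>M)"
    and N: "(\<integral>\<^sup>+ \<omega>. ?N \<omega> \<partial>M) = (\<integral>\<^sup>+ \<omega>. neg_part (?Y \<omega>) \<partial>M)"
    by (intro nn_integral_nn_cond_exp; measurable)+
  have fin: "(\<integral>\<^sup>+ \<omega>. ?P \<omega> \<partial>M) < \<infinity> \<or> (\<integral>\<^sup>+ \<omega>. ?N \<omega> \<partial>M) < \<infinity>"
    using assms(4) unfolding ereal_expectation_defined_def P N by (auto simp: min_less_iff_disj)
  \<comment> \<open>A finite integral makes the corresponding conditional part finite almost
    everywhere, so the difference of \<open>?P\<close> and \<open>?N\<close> is almost surely not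
    \<infinity> - \<infinity>.\<close>
  then have "(AE \<omega> in M. ?P \<omega> \<noteq> \<infinity>) \<or> (AE \<omega> in M. ?N \<omega> \<noteq> \<infinity>)"
    using nn_integral_PInf_AE[OF borel_measurable_nn_cond_exp2] by (metis less_irrefl)
  then have "AE \<omega> in M. ?P \<omega> < \<infinity> \<or> ?N \<omega> < \<infinity>"
    by (auto simp: less_top elim: eventually_mono)
  with le have "AE \<omega> in M. ereal_cond_exp M G ?Y \<omega> \<le> ?Z \<omega>"
  proof eventually_elim
    case (elim \<omega>)
    then show ?case
      unfolding ereal_cond_exp_def using enn2ereal_diff_mono pos_part_minus_neg_part by metis
  qed
  \<comment> \<open>The additive inequality is integrated before any subtraction, so no \<infinity>
    - \<infinity> arises under the integral.\<close>
  moreover have "(\<integral>\<^sup>+ \<omega>. ?P \<omega> \<partial>M) + (\<integral>\<^sup>+ \<omega>. neg_part (?Z \<omega>) \<partial>M)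
      \<le> (\<integral>\<^sup>+ \<omega>. ?N \<omega> \<partial>M) + (\<integral>\<^sup>+ \<omega>. pos_part (?Z \<omega>) \<partial>M)"
    using nn_integral_mono_AE[OF le] by (simp add: nn_integral_add)
  then have "ereal_expectation M ?Y \<le> ereal_expectation M ?Z"
    unfolding ereal_expectation_def P[symmetric] N[symmetric] using fin by (rule enn2ereal_diff_mono)
  ultimately show ?thesis by blast
qed

end
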